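(* Let $k>0$ be fixed and consider the Pareto model. (a) If the parameter set is $\Theta=(1,\infty)$, then for every $\beta\in(0,1)$ the DR-minmaxvar risk $(\mathcal{E}^{k,\gamma}_{\mathcal{Q}|\mathbf{x}_N}\circ \mathrm{D}_{\lambda_{\beta}})(X)$ is not regularizable. (b) If instead the parameter set is $\Theta=(\tilde\theta,\infty)$ for some $\tilde\theta>1$, then the DR-minmaxvar risk $(\mathcal{E}^{k,\gamma}_{\mathcal{Q}|\mathbf{x}_N}\circ \mathrm{D}_{\lambda_{\beta_N}})(X)$ is regularizable whenever $(\beta_N)_{N\ge1}$ is a sequence in $(0,1]$ satisfying $$\beta_N\ \ge\ \frac1{\tilde\theta}+\frac{1}{|h_N|}\qquad\text{for some nonzero real sequence } h_N=O(N^{\eta}),$$ where $\eta=1/4$ in the case $\gamma=1$, and $\eta<1/4$ in the case of general $\gamma\in[1,\infty)$.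
   Context: Pareto model: $X, X_1,X_2,\dots$ are real random variables and $\mathcal{Q}=\{Q_\theta:\theta\in\Theta\}$ is the family of measures under which they are iid with density $f(x;\theta)=\theta x^{-(1+\theta)}$ for $x>1$. Write $\mathbf{x}_N=(X_1,\dots,X_N)$, $\ell(\mathbf{x}_N;\theta)=\sum_{i=1}^N\log f(X_i;\theta)$, and define the divergence $\alpha_{\mathcal{Q}|\mathbf{x}_N}(\theta)=\sup_{\theta'\in\Theta}\ell(\mathbf{x}_N;\theta')-\ell(\mathbf{x}_N;\theta)$. For $\delta\in\mathbb{R}$, the $\delta$-truncation is $\alpha^{(\delta)}_{\mathcal{Q}|\mathbf{x}_N}(\theta)=\alpha_{\mathcal{Q}|\mathbf{x}_N}(\theta)$ if $\alpha_{\mathcal{Q}|\mathbf{x}_N}(\theta)\le N^\delta$ and $+\infty$ otherwise. For a risk assessment $\mathcal{R}$ (a map from laws on $\mathbb{R}$ to values in $(-\infty,\infty]$), write $\mathcal{R}_\theta$ for its value on the law of $X$ under $Q_\theta$. For $k>0$ and $\gamma\in[1,\infty]$, put $$(\mathcal{E}^{k,\gamma,\delta}_{\mathcal{Q}|\mathbf{x}_N}\circ\mathcal{R})(X)=\sup_{\theta\in\Theta}\Big\{\mathcal{R}_\theta-\Big(\tfrac1k\alpha^{(\delta)}_{\mathcal{Q}|\mathbf{x}_N}(\theta)\Big)^\gamma\Big\},$$ where $|x|^\infty=0$ for $|x|\le1$ and $|x|^\infty=\infty$ otherwise, and parameters with infinite penalty are excluded from the supremum. This quantity is called regular (for given observations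 $\mathbf{x}_N$) if the supremum is finite and attained at a point $\theta$ with $\alpha_{\mathcal{Q}|\mathbf{x}_N}(\theta)<N^\delta$. For a sequence $(\mathcal{R}_N)$ of risk assessments, $(\mathcal{E}^{k,\gamma}_{\mathcal{Q}|\mathbf{x}_N}\circ\mathcal{R}_N)(X)$ is called regularizable if there exists $\delta>0$ such that, for every $P\in\mathcal{Q}$, with $P$-probability tending to $1$ as $N\to\infty$, $(\mathcal{E}^{k,\gamma,\delta}_{\mathcal{Q}|\mathbf{x}_N}\circ\mathcal{R}_N)(X)$ is regular. For a convex increasing bijection $\lambda:[0,1]\to[0,1]$, the distortion risk under $Q_\theta$ is $\mathrm{D}_\lambda(X)=\int_1^\infty\lambda'(1-x^{-\theta})\,\theta x^{-\theta}\,dx\in(0,\infty]$ (the expectation of $X$ computed with the transformed cdf $\lambda(F_\theta(x))$, where $F_\theta(x)=1-x^{-\theta}$). The minmaxvar transform with parameter $\beta\in(0,1]$ is $\lambda_\beta(x)=1-(1-x)^\beta$. *)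

theory Defs
  imports "HOL-Probability.Probability"
begin

definition pareto_density :: "real \<Rightarrow> real \<Rightarrow> real" where
  "pareto_density \<theta> x = (if 1 < x then \<theta> * x powr (-(1 + \<theta>)) else 0)"

(* X 0 is the variable whose risk is assessed; X 1, X 2, ... are the observations. *)
locale pareto_model =
  fixes \<Theta> :: "real set" and Q :: "real \<Rightarrow> 'a measure" and X :: "nat \<Rightarrow> 'a \<Rightarrow> real"
  assumes pos: "\<theta> \<in> \<Theta> \<Longrightarrow> 0 < \<theta>"
    and prob: "\<theta> \<in> \<Theta> \<Longrightarrow> prob_space (Q \<theta>)"
    and sets_eq: "\<theta> \<in> \<Theta> \<Longrightarrow> \<theta>' \<in> \<Theta> \<Longrightarrow> sets (Q \<theta>) = sets (Q \<theta>')"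
    and indep: "\<theta> \<in> \<Theta> \<Longrightarrow> prob_space.indep_vars (Q \<theta>) (\<lambda>_. borel) X UNIV"
    and law: "\<theta> \<in> \<Theta> \<Longrightarrow> distributed (Q \<theta>) lborel (X i) (\<lambda>x. ennreal (pareto_density \<theta> x))"

(* The observations are xs 1, ..., xs N. The convention ln 0 = 0 is harmless here: the density
   vanishes only on (-\<infinity>, 1], which is a null set under every Q \<theta>. *)
definition loglik :: "nat \<Rightarrow> (nat \<Rightarrow> real) \<Rightarrow> real \<Rightarrow> real" where
  "loglik N xs \<theta> = (\<Sum>i=1..N. ln (pareto_density \<theta> (xs i)))"

definition divergence :: "real set \<Rightarrow> nat \<Rightarrow> (nat \<Rightarrow> real) \<Rightarrow> real \<Rightarrow> ereal" where
  "divergence \<Theta> N xs \<theta> = (SUP \<theta>'\<in>\<Theta>. ereal (loglik N xs \<theta>')) - ereal (loglik N xs \<theta>)"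

definition truncated_divergence ::
    "real set \<Rightarrow> real \<Rightarrow> nat \<Rightarrow> (nat \<Rightarrow> real) \<Rightarrow> real \<Rightarrow> ereal" where
  "truncated_divergence \<Theta> \<delta> N xs \<theta> =
     (if divergence \<Theta> N xs \<theta> \<le> ereal (real N powr \<delta>) then divergence \<Theta> N xs \<theta> else \<infinity>)"

(* |x| to the power \<gamma>, for \<gamma> in [1, \<infinity>] *)
definition abs_power :: "ereal \<Rightarrow> ereal \<Rightarrow> ereal" where
  "abs_power x \<gamma> =
     (if \<gamma> = \<infinity> then (if \<bar>x\<bar> \<le> 1 then 0 else \<infinity>)
      else if \<bar>x\<bar> = \<infinity> then \<infinity>
      else ereal (\<bar>real_of_ereal x\<bar> powr real_of_ereal \<gamma>))"

definition penalty ::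
    "real set \<Rightarrow> real \<Rightarrow> ereal \<Rightarrow> real \<Rightarrow> nat \<Rightarrow> (nat \<Rightarrow> real) \<Rightarrow> real \<Rightarrow> ereal" where
  "penalty \<Theta> k \<gamma> \<delta> N xs \<theta> = abs_power (ereal (1 / k) * truncated_divergence \<Theta> \<delta> N xs \<theta>) \<gamma>"

(* A risk assessment maps laws on the real line to extended reals; in the next two definitions,
   r \<theta> is its value on the law of X under Q \<theta>. *)
type_synonym risk_assessment = "real measure \<Rightarrow> ereal"

definition DR_risk ::
    "real set \<Rightarrow> real \<Rightarrow> ereal \<Rightarrow> real \<Rightarrow> nat \<Rightarrow> (nat \<Rightarrow> real) \<Rightarrow> (real \<Rightarrow> ereal) \<Rightarrow> ereal" where
  "DR_risk \<Theta> k \<gamma> \<delta> N xs r =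
     (SUP \<theta>\<in>{\<theta> \<in> \<Theta>. penalty \<Theta> k \<gamma> \<delta> N xs \<theta> \<noteq> \<infinity>}. r \<theta> - penalty \<Theta> k \<gamma> \<delta> N xs \<theta>)"

definition regular ::
    "real set \<Rightarrow> real \<Rightarrow> ereal \<Rightarrow> real \<Rightarrow> nat \<Rightarrow> (nat \<Rightarrow> real) \<Rightarrow> (real \<Rightarrow> ereal) \<Rightarrow> bool" where
  "regular \<Theta> k \<gamma> \<delta> N xs r \<longleftrightarrow>
     \<bar>DR_risk \<Theta> k \<gamma> \<delta> N xs r\<bar> \<noteq> \<infinity> \<and>
     (\<exists>\<theta>\<in>\<Theta>. penalty \<Theta> k \<gamma> \<delta> N xs \<theta> \<noteq> \<infinity> \<and>
        r \<theta> - penalty \<Theta> k \<gamma> \<delta> N xs \<theta> = DR_risk \<Theta> k \<gamma> \<delta> N xs r \<and>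
        divergence \<Theta> N xs \<theta> < ereal (real N powr \<delta>))"

(* Stated through measurable subevents (inner probability), since the set of outcomes satisfying
   A N need not be measurable. For measurable sets this is convergence of the probabilities to 1. *)
definition prob_tends_to_1 :: "'a measure \<Rightarrow> (nat \<Rightarrow> 'a \<Rightarrow> bool) \<Rightarrow> bool" where
  "prob_tends_to_1 P A \<longleftrightarrow>
     (\<exists>E. (\<forall>N. E N \<in> sets P \<and> (\<forall>\<omega>\<in>E N. A N \<omega>)) \<and> (\<lambda>N. measure P (E N)) \<longlonglongrightarrow> 1)"

definition regularizable ::
    "real set \<Rightarrow> (real \<Rightarrow> 'a measure) \<Rightarrow> (nat \<Rightarrow> 'a \<Rightarrow> real) \<Rightarrow> real \<Rightarrow> ereal \<Rightarrow>
     (nat \<Rightarrow> risk_assessment) \<Rightarrow> bool" where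
  "regularizable \<Theta> Q X k \<gamma> R \<longleftrightarrow>
     (\<exists>\<delta>>0. \<forall>\<theta>\<^sub>0\<in>\<Theta>. prob_tends_to_1 (Q \<theta>\<^sub>0)
        (\<lambda>N \<omega>. regular \<Theta> k \<gamma> \<delta> N (\<lambda>i. X i \<omega>) (\<lambda>\<theta>. R N (distr (Q \<theta>) borel (X 0)))))"

(* For an atomless law \<mu> with cdf F this is the expectation, positive part minus negative part,
   under the law with cdf g \<circ> F, whose density with respect to \<mu> is g' \<circ> F. On Pareto laws it is
   the integral in lemma distortion_risk_pareto. *)
definition distortion_risk :: "(real \<Rightarrow> real) \<Rightarrow> risk_assessment" where
  "distortion_risk g \<mu> =
     enn2ereal (\<integral>\<^sup>+x. ennreal (deriv g (cdf \<mu> x) * x) \<partial>\<mu>) -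
     enn2ereal (\<integral>\<^sup>+x. ennreal (- (deriv g (cdf \<mu> x) * x)) \<partial>\<mu>)"

lemma pareto_density_measurable [measurable]: "pareto_density \<theta> \<in> borel_measurable borel"
  unfolding pareto_density_def by measurable

lemma (in pareto_model) distr_eq_density:
  assumes "\<theta> \<in> \<Theta>"
  shows "distr (Q \<theta>) borel (X i) = density lborel (\<lambda>x. ennreal (pareto_density \<theta> x))"
proof -
  have "distr (Q \<theta>) borel (X i) = distr (Q \<theta>) lborel (X i)"
    by (rule distr_cong) auto
  then show ?thesis
    using distributed_distr_eq_density[OF law[OF assms, of i]] by simp
qed

lemma cdf_pareto:
  assumes "0 < \<theta>" "1 < x"
  shows "cdf (density lborel (\<lambda>x. ennreal (pareto_density \<theta> x))) x = 1 - x powr (-\<theta>)"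
proof -
  have "emeasure (density lborel (\<lambda>x. ennreal (pareto_density \<theta> x))) {..x} =
      (\<integral>\<^sup>+t. ennreal (pareto_density \<theta> t) * indicator {..x} t \<partial>lborel)"
    by (subst emeasure_density) auto
  also have "\<dots> = (\<integral>\<^sup>+t. ennreal (\<theta> * t powr (-(1 + \<theta>))) * indicator {1..x} t \<partial>lborel)"
  proof (rule nn_integral_cong_AE)
    show "AE t in lborel. ennreal (pareto_density \<theta> t) * indicator {..x} t =
        ennreal (\<theta> * t powr (-(1 + \<theta>))) * indicator {1..x} t"
      using AE_lborel_singleton[of 1]
      by eventually_elim (auto simp: pareto_density_def indicator_def)
  qed
  also have "\<dots> = ennreal (- (x powr (-\<theta>)) - (- (1 powr (-\<theta>))))"
  proof (rule nn_integral_FTC_Icc[where F = "\<lambda>t. - (t powr (-\<theta>))"])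
    fix t assume t: "t \<in> {1..x}"
    have "((\<lambda>t. - (t powr (-\<theta>))) has_real_derivative - ((-\<theta>) * t powr (-\<theta> - 1))) (at t)"
      using t by (intro DERIV_minus has_real_derivative_powr) auto
    moreover have "- ((-\<theta>) * t powr (-\<theta> - 1)) = \<theta> * t powr (-(1 + \<theta>))"
      by (simp add: minus_diff_commute)
    ultimately show "((\<lambda>t. - (t powr (-\<theta>))) has_real_derivative
        \<theta> * t powr (-(1 + \<theta>))) (at t)"
      by (simp only:)
  qed (use assms in auto)
  finally have *: "emeasure (density lborel (\<lambda>x. ennreal (pareto_density \<theta> x))) {..x} =
      ennreal (1 - x powr (-\<theta>))" by simp
  have "x powr (-\<theta>) \<le> 1"
    using assms by (simp add: powr_minus_divide ge_one_powr_ge_zero)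
  then show ?thesis
    unfolding cdf_def measure_def * by simp
qed

lemma distortion_risk_pareto:
  assumes \<theta>: "0 < \<theta>" and nonneg: "\<And>u. 0 < u \<Longrightarrow> u < 1 \<Longrightarrow> 0 \<le> deriv g u"
    and meas: "set_borel_measurable borel {0<..<1} (deriv g)"
  shows "distortion_risk g (density lborel (\<lambda>x. ennreal (pareto_density \<theta> x))) =
    enn2ereal (\<integral>\<^sup>+x\<in>{1<..}. ennreal (deriv g (1 - x powr (-\<theta>)) * \<theta> * x powr (-\<theta>)) \<partial>lborel)"
proof -
  define f where "f = (\<lambda>x. ennreal (pareto_density \<theta> x))"
  define \<mu> where "\<mu> = density lborel f"
  have f [measurable]: "f \<in> borel_measurable lborel" unfolding f_def by measurable
  have ae: "AE x in \<mu>. 1 < x"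
    unfolding \<mu>_def by (subst AE_density) (auto simp: f_def pareto_density_def)
  have cdf: "cdf \<mu> x = 1 - x powr (-\<theta>)" if "1 < x" for x
    using cdf_pareto[OF \<theta> that] by (simp add: \<mu>_def f_def)
  have range: "0 < 1 - x powr (-\<theta>)" "1 - x powr (-\<theta>) < 1" if "1 < x" for x
    using \<theta> that powr_less_one[of x "-\<theta>"] by auto
  define d where "d = (\<lambda>u. indicator {0<..<1} u *\<^sub>R deriv g u)"
  have d [measurable]: "d \<in> borel_measurable borel"
    using meas unfolding set_borel_measurable_def d_def .
  have d_eq: "deriv g (cdf \<mu> x) = d (1 - x powr (-\<theta>))" if "1 < x" for x
    using range[OF that] by (simp add: d_def cdf[OF that])
  have d_nonneg: "0 \<le> d u" for u
    using nonneg by (auto simp: d_def indicator_def)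
  have "(\<integral>\<^sup>+x. ennreal (- (deriv g (cdf \<mu> x) * x)) \<partial>\<mu>) = (\<integral>\<^sup>+x. 0 \<partial>\<mu>)"
    by (intro nn_integral_cong_AE, use ae in eventually_elim)
       (use d_nonneg in \<open>auto simp: d_eq ennreal_eq_0_iff\<close>)
  moreover have "(\<integral>\<^sup>+x. ennreal (deriv g (cdf \<mu> x) * x) \<partial>\<mu>) =
      (\<integral>\<^sup>+x. ennreal (d (1 - x powr (-\<theta>)) * x) \<partial>\<mu>)"
    by (intro nn_integral_cong_AE, use ae in eventually_elim) (auto simp: d_eq)
  moreover have "\<dots> = (\<integral>\<^sup>+x. f x * ennreal (d (1 - x powr (-\<theta>)) * x) \<partial>lborel)"
    unfolding \<mu>_def by (rule nn_integral_density) auto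
  moreover have "\<dots> = (\<integral>\<^sup>+x\<in>{1<..}. ennreal (deriv g (1 - x powr (-\<theta>)) * \<theta> * x powr (-\<theta>)) \<partial>lborel)"
  proof (rule nn_integral_cong)
    fix x :: real
    show "f x * ennreal (d (1 - x powr (-\<theta>)) * x) =
      ennreal (deriv g (1 - x powr (-\<theta>)) * \<theta> * x powr (-\<theta>)) * indicator {1<..} x"
    proof (cases "1 < x")
      case True
      have "x powr (-\<theta>) = x powr (-(1 + \<theta>)) * x"
        using True by (simp add: powr_mult_base mult.commute)
      moreover have "d (1 - x powr (-\<theta>)) = deriv g (1 - x powr (-\<theta>))"
        using range[OF True] by (simp add: d_def)
      ultimately show ?thesis
        using True \<theta> d_nonneg[of "1 - x powr (-\<theta>)"]
        by (simp add: f_def pareto_density_def flip: ennreal_mult)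
    qed (simp add: f_def pareto_density_def)
  qed
  ultimately show ?thesis
    unfolding distortion_risk_def \<mu>_def[symmetric] f_def[symmetric] by (simp add: zero_ennreal.rep_eq)
qed

definition minmaxvar :: "real \<Rightarrow> real \<Rightarrow> real" where
  "minmaxvar \<beta> x = 1 - (1 - x) powr \<beta>"

end

theory Submission
  imports Defs
begin

text \<open>With \<open>s\<close> the mean of the \<open>ln X\<^sub>i\<close>, the maximum likelihood estimator is \<open>1 / s\<close> and the divergence
  at \<open>\<theta>\<close> is \<open>N (\<theta> s - 1 - ln (\<theta> s))\<close>. The minmaxvar risk at \<open>\<theta>\<close> is \<open>\<theta> \<beta> / (\<theta> \<beta> - 1)\<close> if \<open>\<theta> \<beta> > 1\<close> and
  infinite otherwise. In (a), for a true parameter in \<open>(1, 1 / \<beta>)\<close> the estimator eventually lies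
  there too, where the penalty vanishes and the risk is infinite. In (b), take \<open>\<delta> = 1 / 2\<close>: the
  divergence away from the true parameter grows linearly in \<open>N\<close>, so the truncation confines the
  supremum to parameters bounded away from \<open>t\<close>. There the risk is bounded uniformly in \<open>N\<close>, since
  \<open>\<beta>\<^sub>N \<ge> 1 / t\<close>, while the penalty at the truncation level tends to infinity.\<close>

section \<open>Log-likelihood and divergence of the Pareto model\<close>

definition log_mean :: "nat \<Rightarrow> (nat \<Rightarrow> real) \<Rightarrow> real" where
  "log_mean N xs = (\<Sum>i=1..N. ln (xs i)) / real N"

text \<open>The relative entropy of the Pareto law with parameter \<open>a\<close> with respect to
  the one with parameter \<open>\<theta>\<close> is \<open>psi (\<theta> / a)\<close>.\<close>

definition psi :: "real \<Rightarrow> real" where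
  "psi u = u - 1 - ln u"

lemma psi_nonneg: "0 < u \<Longrightarrow> 0 \<le> psi u"
  using ln_le_minus_one[of u] by (simp add: psi_def)

lemma psi_1 [simp]: "psi 1 = 0"
  by (simp add: psi_def)

text \<open>The bound \<open>ln (v / u) \<le> v / u - 1\<close> reduces the claim to
  \<open>u - v \<le> (u - v) / u\<close>, which holds because \<open>u \<le> 1\<close>.\<close>

lemma psi_antimono:
  assumes "0 < v" "v \<le> u" "u \<le> 1"
  shows "psi u \<le> psi v"
proof -
  have "ln (v / u) \<le> v / u - 1"
    using assms by (intro ln_le_minus_one) auto
  moreover have "ln (v / u) = ln v - ln u"
    using assms by (simp add: ln_div)
  moreover have "u - v \<le> (u - v) / u"
    using assms by (simp add: le_divide_eq mult_left_le)
  moreover have "(u - v) / u = 1 - v / u"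
    using assms by (simp add: diff_divide_distrib)
  ultimately show ?thesis by (simp add: psi_def)
qed

lemma psi_pos: "0 < u \<Longrightarrow> u < 1 \<Longrightarrow> 0 < psi u"
  using psi_nonneg[of u] ln_eq_minus_one[of u] by (fastforce simp: psi_def)

text \<open>The tangent bound for \<open>ln\<close> at \<open>u / 2\<close> and
  \<open>ln 2 \<le> 1\<close> give \<open>ln u \<le> u / 2\<close>. The linear growth bounds from
  above the parameters that survive the truncation.\<close>

lemma psi_ge_linear:
  assumes "0 < u"
  shows "u / 2 - 1 \<le> psi u"
proof -
  have "ln (u / 2) \<le> u / 2 - 1" "ln (u / 2) = ln u - ln 2" "ln 2 \<le> (1::real)"
    using assms ln_le_minus_one[of "u / 2"] ln_le_minus_one[of 2] by (auto simp: ln_div)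
  then show ?thesis by (simp add: psi_def)
qed

lemma log_mean_pos:
  assumes "1 \<le> N" "\<And>i. i \<in> {1..N} \<Longrightarrow> 1 < xs i"
  shows "0 < log_mean N xs"
  unfolding log_mean_def using assms(1)
  by (intro divide_pos_pos sum_pos ln_gt_zero assms(2)) auto

lemma loglik_eq:
  assumes "1 \<le> N" "\<And>i. i \<in> {1..N} \<Longrightarrow> 1 < xs i" "0 < \<theta>"
  shows "loglik N xs \<theta> = real N * (ln \<theta> - (1 + \<theta>) * log_mean N xs)"
proof -
  have "loglik N xs \<theta> = (\<Sum>i=1..N. ln \<theta> - (1 + \<theta>) * ln (xs i))"
    unfolding loglik_def
  proof (rule sum.cong)
    fix i assume "i \<in> {1..N}"
    then have "1 < xs i" using assms(2) by blast
    then show "ln (pareto_density \<theta> (xs i)) = ln \<theta> - (1 + \<theta>) * ln (xs i)"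
      using assms(3) by (simp add: pareto_density_def ln_mult ln_powr algebra_simps)
  qed simp
  also have "\<dots> = real N * ln \<theta> - (1 + \<theta>) * (\<Sum>i=1..N. ln (xs i))"
    by (simp add: sum_subtractf sum_distrib_left)
  finally show ?thesis
    using assms(1) by (simp add: log_mean_def right_diff_distrib)
qed

text \<open>The log-likelihood at \<open>1 / s\<close> exceeds that at \<open>\<theta>\<close> by
  exactly \<open>N * psi (\<theta> * s)\<close>. Since \<open>psi\<close> is nonnegative and
  \<open>1 / s\<close> lies in \<open>\<Theta>\<close>, the supremum is attained there.\<close>

lemma divergence_eq:
  assumes N: "1 \<le> N" and xs: "\<And>i. i \<in> {1..N} \<Longrightarrow> 1 < xs i"
    and \<Theta>: "\<And>\<theta>. \<theta> \<in> \<Theta> \<Longrightarrow> 0 < \<theta>" and mle: "1 / log_mean N xs \<in> \<Theta>" and \<theta>: "\<theta> \<in> \<Theta>"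
  shows "divergence \<Theta> N xs \<theta> = ereal (real N * psi (\<theta> * log_mean N xs))"
proof -
  define s where "s = log_mean N xs"
  have s: "0 < s" unfolding s_def by (rule log_mean_pos[OF N xs])
  have diff: "loglik N xs (1 / s) - loglik N xs \<theta> = real N * psi (\<theta> * s)" if "0 < \<theta>" for \<theta>
  proof -
    have "loglik N xs (1 / s) = real N * (- ln s - (s + 1))"
      using s by (subst loglik_eq[OF N xs]) (auto simp: s_def[symmetric] ln_div field_simps)
    moreover have "loglik N xs \<theta> = real N * (ln \<theta> - (1 + \<theta>) * s)"
      unfolding s_def by (rule loglik_eq[OF N xs that])
    ultimately show ?thesis
      using s that by (simp add: psi_def ln_mult algebra_simps)
  qed
  have "(SUP \<theta>'\<in>\<Theta>. ereal (loglik N xs \<theta>')) = ereal (loglik N xs (1 / s))"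
  proof (rule antisym)
    show "(SUP \<theta>'\<in>\<Theta>. ereal (loglik N xs \<theta>')) \<le> ereal (loglik N xs (1 / s))"
    proof (rule SUP_least)
      fix \<theta>' assume "\<theta>' \<in> \<Theta>"
      then have pos: "0 < \<theta>'" by (rule \<Theta>)
      have "0 \<le> real N * psi (\<theta>' * s)"
        using s pos by (simp add: psi_nonneg)
      then show "ereal (loglik N xs \<theta>') \<le> ereal (loglik N xs (1 / s))"
        using diff[OF pos] by simp
    qed
    show "ereal (loglik N xs (1 / s)) \<le> (SUP \<theta>'\<in>\<Theta>. ereal (loglik N xs \<theta>'))"
      using mle by (intro SUP_upper) (simp add: s_def)
  qed
  then show ?thesis
    using diff[OF \<Theta>[OF \<theta>]] by (simp add: divergence_def s_def)
qed

section \<open>The minmaxvar risk of a Pareto law\<close>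

lemma deriv_minmaxvar:
  assumes "u < 1"
  shows "deriv (minmaxvar \<beta>) u = \<beta> * (1 - u) powr (\<beta> - 1)"
proof (rule DERIV_imp_deriv)
  show "(minmaxvar \<beta> has_field_derivative \<beta> * (1 - u) powr (\<beta> - 1)) (at u)"
    unfolding minmaxvar_def [abs_def] using assms
    by (auto intro!: derivative_eq_intros)
qed

text \<open>The transform raises the tail \<open>x powr (-\<theta>)\<close> to the power
  \<open>\<beta>\<close>, so the distorted law is again Pareto, with parameter
  \<open>a = \<theta> * \<beta>\<close>. Its mean is \<open>a / (a - 1)\<close> for
  \<open>a > 1\<close> and infinite otherwise.\<close>

lemma distortion_risk_minmaxvar_pareto:
  assumes \<theta>: "0 < \<theta>" and \<beta>: "0 < \<beta>"
  shows "distortion_risk (minmaxvar \<beta>) (density lborel (\<lambda>x. ennreal (pareto_density \<theta> x))) =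
    (if 1 < \<theta> * \<beta> then ereal (\<theta> * \<beta> / (\<theta> * \<beta> - 1)) else \<infinity>)"
proof -
  define a where "a = \<theta> * \<beta>"
  have a: "0 < a" using assms by (simp add: a_def)
  define f where "f = (\<lambda>x::real. ennreal (a * x powr (- a)))"
  have meas: "set_borel_measurable borel {0<..<1} (deriv (minmaxvar \<beta>))"
  proof -
    have "(\<lambda>u::real. indicator {0<..<1} u *\<^sub>R deriv (minmaxvar \<beta>) u) =
        (\<lambda>u. indicator {0<..<1} u *\<^sub>R (\<beta> * (1 - u) powr (\<beta> - 1)))"
      by (auto simp: deriv_minmaxvar indicator_def)
    then show ?thesis unfolding set_borel_measurable_def by simp
  qed
  have "distortion_risk (minmaxvar \<beta>) (density lborel (\<lambda>x. ennreal (pareto_density \<theta> x))) =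
      enn2ereal (\<integral>\<^sup>+x\<in>{1<..}. ennreal (deriv (minmaxvar \<beta>) (1 - x powr (-\<theta>)) * \<theta> * x powr (-\<theta>)) \<partial>lborel)"
    using \<beta> by (intro distortion_risk_pareto \<theta> meas) (auto simp: deriv_minmaxvar)
  also have "(\<integral>\<^sup>+x\<in>{1<..}. ennreal (deriv (minmaxvar \<beta>) (1 - x powr (-\<theta>)) * \<theta> * x powr (-\<theta>)) \<partial>lborel) =
      (\<integral>\<^sup>+x. f x * indicator {1..} x \<partial>lborel)"
  \<comment> \<open>Adding the null set {1} closes the half-line, as the fundamental theorem of
    calculus for nonnegative integrals requires.\<close>
  proof (rule nn_integral_cong_AE)
    show "AE x in lborel. ennreal (deriv (minmaxvar \<beta>) (1 - x powr (-\<theta>)) * \<theta> * x powr (-\<theta>)) *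
        indicator {1<..} x = f x * indicator {1..} x"
      using AE_lborel_singleton[of 1]
    proof eventually_elim
      fix x :: real assume "x \<noteq> 1"
      have "deriv (minmaxvar \<beta>) (1 - x powr (-\<theta>)) * \<theta> * x powr (-\<theta>) = a * x powr (- a)" if "1 < x"
        using that by (simp add: deriv_minmaxvar powr_powr a_def algebra_simps flip: powr_add)
      then show "ennreal (deriv (minmaxvar \<beta>) (1 - x powr (-\<theta>)) * \<theta> * x powr (-\<theta>)) *
          indicator {1<..} x = f x * indicator {1..} x"
        using \<open>x \<noteq> 1\<close> by (auto simp: f_def indicator_def)
    qed
  qed
  also have "enn2ereal \<dots> = (if 1 < a then ereal (a / (a - 1)) else \<infinity>)"
  proof (cases "1 < a")
    case True
    have "(\<integral>\<^sup>+x. f x * indicator {1..} x \<partial>lborel) = ennreal (0 - (- (a / (a - 1)) * 1 powr (1 - a)))"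
      unfolding f_def
    proof (rule nn_integral_FTC_atLeast[where F = "\<lambda>x. - (a / (a - 1)) * x powr (1 - a)"])
      fix x :: real assume x: "1 \<le> x"
      have "((\<lambda>x. - (a / (a - 1)) * x powr (1 - a)) has_real_derivative
          - (a / (a - 1)) * ((1 - a) * x powr (1 - a - 1))) (at x)"
        using x by (intro DERIV_cmult has_real_derivative_powr) auto
      moreover have "- (a / (a - 1)) * ((1 - a) * x powr (1 - a - 1)) = a * x powr (- a)"
        using True by (simp add: field_simps)
      ultimately show "((\<lambda>x. - (a / (a - 1)) * x powr (1 - a)) has_real_derivative
          a * x powr (- a)) (at x)" by simp
      show "0 \<le> a * x powr (- a)" using a by simp
    next
      have "((\<lambda>x::real. x powr (1 - a)) \<longlongrightarrow> 0) at_top"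
        using True by (intro tendsto_neg_powr filterlim_ident) auto
      from tendsto_mult_left[OF this, of "- (a / (a - 1))"]
      show "((\<lambda>x. - (a / (a - 1)) * x powr (1 - a)) \<longlongrightarrow> 0) at_top" by simp
    qed simp
    then show ?thesis using True by (simp add: enn2ereal_ennreal)
  next
    case False
    \<comment> \<open>For \<open>a \<le> 1\<close> the integrand dominates \<open>a / x\<close>,
      whose integral up to \<open>y\<close> is the unbounded \<open>a * ln y\<close>.\<close>
    have lower: "ennreal (a * ln y) \<le> (\<integral>\<^sup>+x. f x * indicator {1..} x \<partial>lborel)" if "1 \<le> y" for y
    proof -
      have "(\<integral>\<^sup>+x. ennreal (a * inverse x) * indicator {1..y} x \<partial>lborel) = ennreal (a * ln y - a * ln 1)"
        using that a
        by (intro nn_integral_FTC_Icc[where F = "\<lambda>x. a * ln x"]) (auto intro!: derivative_eq_intros simp: field_simps)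
      moreover have "(\<integral>\<^sup>+x. ennreal (a * inverse x) * indicator {1..y} x \<partial>lborel) \<le>
          (\<integral>\<^sup>+x. f x * indicator {1..} x \<partial>lborel)"
      proof (rule nn_integral_mono)
        fix x :: real
        have "inverse x \<le> x powr (- a)" if "1 \<le> x"
          using powr_mono[of "-1" "- a" x] that False by (simp add: powr_minus)
        then show "ennreal (a * inverse x) * indicator {1..y} x \<le> f x * indicator {1..} x"
          using a by (auto simp: f_def indicator_def intro!: ennreal_leI)
      qed
      ultimately show ?thesis by simp
    qed
    have "(\<integral>\<^sup>+x. f x * indicator {1..} x \<partial>lborel) = \<infinity>"
    proof (rule ccontr)
      assume "(\<integral>\<^sup>+x. f x * indicator {1..} x \<partial>lborel) \<noteq> \<infinity>"
      then obtain r where r: "0 \<le> r" "(\<integral>\<^sup>+x. f x * indicator {1..} x \<partial>lborel) = ennreal r"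
        by (cases "\<integral>\<^sup>+x. f x * indicator {1..} x \<partial>lborel") auto
      \<comment> \<open>This choice of \<open>y\<close> makes the lower bound equal to
        \<open>r + 1\<close>.\<close>
      show False
        using lower[of "exp ((r + 1) / a)"] r a by simp
    qed
    then show ?thesis using False by simp
  qed
  finally show ?thesis by (simp add: a_def)
qed

section \<open>Regularity for fixed observations\<close>

text \<open>The divergence vanishes at the maximum likelihood estimator, so it passes every
  truncation and its penalty is 0, also for \<open>\<gamma> = \<infinity>\<close>. An infinite risk
  there makes the supremum infinite.\<close>

lemma not_regular_of_infinite_risk_at_mle:
  assumes N: "1 \<le> N" and xs: "\<And>i. i \<in> {1..N} \<Longrightarrow> 1 < xs i"
    and \<Theta>: "\<And>\<theta>. \<theta> \<in> \<Theta> \<Longrightarrow> 0 < \<theta>" and mle: "1 / log_mean N xs \<in> \<Theta>"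
    and r: "r (1 / log_mean N xs) = \<infinity>" and \<gamma>: "1 \<le> \<gamma>"
  shows "\<not> regular \<Theta> k \<gamma> \<delta> N xs r"
proof -
  let ?\<theta> = "1 / log_mean N xs"
  have "0 < log_mean N xs" by (rule log_mean_pos[OF N xs])
  then have "divergence \<Theta> N xs ?\<theta> = 0"
    using divergence_eq[OF N xs \<Theta> mle mle] by (simp add: zero_ereal_def)
  then have pen: "penalty \<Theta> k \<gamma> \<delta> N xs ?\<theta> = 0"
    by (simp add: penalty_def truncated_divergence_def abs_power_def)
  have "r ?\<theta> - penalty \<Theta> k \<gamma> \<delta> N xs ?\<theta> \<le> DR_risk \<Theta> k \<gamma> \<delta> N xs r"
    unfolding DR_risk_def by (rule SUP_upper) (use mle pen in auto)
  then have "DR_risk \<Theta> k \<gamma> \<delta> N xs r = \<infinity>"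
    using r pen by (simp add: zero_ereal_def)
  then show ?thesis by (simp add: regular_def)
qed

text \<open>A maximizer exists by compactness. Where the divergence equals \<open>N powr \<delta>\<close>, the penalty is at
  least the risk, while the objective is positive at the maximum likelihood estimator.\<close>

lemma regular_minmaxvar_risk:
  fixes \<beta> k m t :: real
  assumes N: "1 \<le> N" and xs: "\<And>i. i \<in> {1..N} \<Longrightarrow> 1 < xs i"
    and t: "0 < t" "t < m" and m: "m * log_mean N xs < 1"
    and k: "0 < k" and \<gamma>: "1 \<le> \<gamma>" "\<gamma> < \<infinity>" and \<beta>: "1 / t \<le> \<beta>"
    and small: "real N powr \<delta> < real N * psi (m * log_mean N xs)"
    and large: "k * (m / (m - t)) \<le> real N powr \<delta>"
    and r: "\<And>\<theta>. t < \<theta> \<Longrightarrow> r \<theta> = ereal (\<theta> * \<beta> / (\<theta> * \<beta> - 1))"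
  shows "regular {t<..} k \<gamma> \<delta> N xs r"
proof -
  define s where "s = log_mean N xs"
  define c where "c = real N powr \<delta> / real N"
  obtain g where g: "\<gamma> = ereal g" "1 \<le> g"
    using \<gamma> by (cases \<gamma>) auto
  have s: "0 < s" unfolding s_def by (rule log_mean_pos[OF N xs])
  have N0: "0 < real N" using N by simp
  have mle: "1 / s \<in> {t<..}"
  proof -
    have "m < 1 / s" using m s by (simp add: s_def less_divide_eq)
    then show ?thesis using t by simp
  qed
  \<comment> \<open>\<open>K\<close> collects the parameters of finite penalty, and
    \<open>\<phi>\<close> is the real-valued objective on it.\<close>
  define K where "K = {\<theta>. t < \<theta> \<and> real N * psi (\<theta> * s) \<le> real N powr \<delta>}"
  define \<phi> where "\<phi> \<theta> = \<theta> * \<beta> / (\<theta> * \<beta> - 1) - \<bar>real N * psi (\<theta> * s) / k\<bar> powr g" for \<theta>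
  have dvg: "divergence {t<..} N xs \<theta> = ereal (real N * psi (\<theta> * s))" if "t < \<theta>" for \<theta>
    using divergence_eq[OF N xs, where \<Theta> = "{t<..}" and \<theta> = \<theta>] mle t that by (auto simp: s_def)
  have pen: "penalty {t<..} k \<gamma> \<delta> N xs \<theta> =
      (if \<theta> \<in> K then ereal (\<bar>real N * psi (\<theta> * s) / k\<bar> powr g) else \<infinity>)" if "t < \<theta>" for \<theta>
    using that g k by (auto simp: penalty_def truncated_divergence_def dvg K_def abs_power_def)
  have DR: "DR_risk {t<..} k \<gamma> \<delta> N xs r = (SUP \<theta>\<in>K. ereal (\<phi> \<theta>))"
  proof -
    have "{\<theta> \<in> {t<..}. penalty {t<..} k \<gamma> \<delta> N xs \<theta> \<noteq> \<infinity>} = K"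
      using pen by (auto simp: K_def split: if_splits)
    moreover have "r \<theta> - penalty {t<..} k \<gamma> \<delta> N xs \<theta> = ereal (\<phi> \<theta>)" if "\<theta> \<in> K" for \<theta>
    proof -
      have "t < \<theta>" using that by (simp add: K_def)
      then show ?thesis using that by (simp add: pen r \<phi>_def)
    qed
    ultimately show ?thesis
      unfolding DR_risk_def by (simp cong: SUP_cong_simp)
  qed
  \<comment> \<open>Below \<open>m\<close> the argument of \<open>psi\<close> stays under 1, where
    \<open>psi\<close> decreases. By \<open>small\<close> the truncation already excludes
    \<open>m\<close>, hence everything below it.\<close>
  have Km: "m \<le> \<theta>" if "\<theta> \<in> K" for \<theta>
  proof (rule ccontr)
    assume "\<not> m \<le> \<theta>"
    then have "psi (m * s) \<le> psi (\<theta> * s)"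
      using that s t m by (intro psi_antimono) (auto simp: K_def s_def[symmetric])
    then have "real N * psi (m * s) \<le> real N * psi (\<theta> * s)"
      using N0 by simp
    then show False using that small by (simp add: K_def s_def)
  qed
  \<comment> \<open>The map \<open>a / (a - 1) = 1 + 1 / (a - 1)\<close> decreases in
    \<open>a\<close>, and \<open>\<theta> * \<beta> \<ge> m / t\<close>. The resulting bound does
    not depend on \<open>\<beta>\<close>.\<close>
  have bound: "1 < \<theta> * \<beta>" "\<theta> * \<beta> / (\<theta> * \<beta> - 1) \<le> m / (m - t)" if "m \<le> \<theta>" for \<theta>
  proof -
    have "m * (1 / t) \<le> \<theta> * \<beta>"
      using that t \<beta> by (intro mult_mono) auto
    then have le: "m / t \<le> \<theta> * \<beta>" by simp
    have gt: "1 < m / t" using t by simp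
    show "1 < \<theta> * \<beta>" using le gt by linarith
    have "1 / (\<theta> * \<beta> - 1) \<le> 1 / (m / t - 1)"
      using le gt by (intro divide_left_mono) auto
    moreover have "\<theta> * \<beta> / (\<theta> * \<beta> - 1) = 1 + 1 / (\<theta> * \<beta> - 1)"
      using \<open>1 < \<theta> * \<beta>\<close> by (simp add: field_simps)
    moreover have "m / (m - t) = 1 + 1 / (m / t - 1)"
      using t by (simp add: field_simps)
    ultimately show "\<theta> * \<beta> / (\<theta> * \<beta> - 1) \<le> m / (m - t)" by simp
  qed
  \<comment> \<open>The upper endpoint comes from
    \<open>\<theta> * s / 2 - 1 \<le> psi (\<theta> * s) \<le> c\<close>. Written as a compact
    interval intersected with a closed set, \<open>K\<close> is seen to be compact.\<close>
  have K_eq: "K = {m..2 * (c + 1) / s} \<inter> {\<theta> \<in> {m..2 * (c + 1) / s}. real N * psi (\<theta> * s) \<le> real N powr \<delta>}"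
  proof -
    have "\<theta> \<le> 2 * (c + 1) / s" if "\<theta> \<in> K" for \<theta>
    proof -
      have "\<theta> * s / 2 - 1 \<le> psi (\<theta> * s)"
        using that t s by (intro psi_ge_linear) (auto simp: K_def)
      moreover have "psi (\<theta> * s) \<le> c"
        using that N0 by (simp add: K_def c_def field_simps)
      ultimately show ?thesis using s by (simp add: field_simps)
    qed
    then show ?thesis using Km t by (auto simp: K_def)
  qed
  have cont_psi: "continuous_on {m..b} (\<lambda>\<theta>. psi (\<theta> * s))" for b
    unfolding psi_def using s t by (intro continuous_intros) auto
  have "compact K"
    unfolding K_eq
    by (intro compact_Int_closed compact_Icc continuous_on_closed_Collect_le)
       (auto intro!: continuous_intros cont_psi)
  moreover have "1 / s \<in> K"
    using mle s N0 by (simp add: K_def)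
  \<comment> \<open>The base of the power vanishes at \<open>1 / s\<close>; continuity there rests
    on the exponent \<open>g\<close> being positive.\<close>
  moreover have "continuous_on K \<phi>"
  proof (rule continuous_on_subset)
    have "\<theta> * \<beta> - 1 \<noteq> 0" if "m \<le> \<theta>" for \<theta>
      using bound[OF that] by simp
    then show "continuous_on {m..2 * (c + 1) / s} \<phi>"
      unfolding \<phi>_def using k g
      by (intro continuous_intros continuous_on_powr' cont_psi) auto
    show "K \<subseteq> {m..2 * (c + 1) / s}" using K_eq by blast
  qed
  ultimately obtain \<theta> where \<theta>: "\<theta> \<in> K" and max: "\<And>\<theta>'. \<theta>' \<in> K \<Longrightarrow> \<phi> \<theta>' \<le> \<phi> \<theta>"
    using continuous_attains_sup[of K \<phi>] by blast
  have DR_eq: "DR_risk {t<..} k \<gamma> \<delta> N xs r = ereal (\<phi> \<theta>)"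
    unfolding DR by (rule antisym) (auto intro!: SUP_least SUP_upper2[OF \<theta>] max)
  have "real N * psi (\<theta> * s) < real N powr \<delta>"
  proof (rule ccontr)
    assume "\<not> real N * psi (\<theta> * s) < real N powr \<delta>"
    then have eq: "real N * psi (\<theta> * s) = real N powr \<delta>"
      using \<theta> by (simp add: K_def)
    have "m / (m - t) \<le> real N powr \<delta> / k"
      using large k by (simp add: field_simps)
    \<comment> \<open>A base of at least 1 does not shrink when raised to \<open>g \<ge> 1\<close>,
      so the penalty also dominates the risk bound \<open>m / (m - t)\<close>.\<close>
    moreover have "1 \<le> m / (m - t)" using t by simp
    ultimately have "1 \<le> real N powr \<delta> / k" by linarith
    then have "real N powr \<delta> / k \<le> (real N powr \<delta> / k) powr g"
      using powr_mono[of 1 g "real N powr \<delta> / k"] g k by (simp add: powr_one)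
    with \<open>m / (m - t) \<le> real N powr \<delta> / k\<close> have "\<phi> \<theta> \<le> 0"
      using bound(2)[OF Km[OF \<theta>]] k by (simp add: \<phi>_def eq)
    moreover have "1 / s * \<beta> > 1"
      using bound(1)[OF Km[OF \<open>1 / s \<in> K\<close>]] .
    \<comment> \<open>At \<open>1 / s\<close> the penalty is 0 and only the positive risk
      remains.\<close>
    then have "0 < \<phi> (1 / s)"
      using s g by (simp add: \<phi>_def)
    ultimately show False using max[OF \<open>1 / s \<in> K\<close>] by simp
  qed
  then show ?thesis
    unfolding regular_def DR_eq using \<theta>
    by (intro conjI bexI[of _ \<theta>]) (auto simp: pen dvg r \<phi>_def K_def)
qed

section \<open>A weak law of large numbers for the logarithms of the observations\<close>

context pareto_model
begin

lemma X_measurable: "\<theta> \<in> \<Theta> \<Longrightarrow> X i \<in> borel_measurable (Q \<theta>)"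
  using distributed_measurable[OF law] by simp

lemma AE_X_gt_1:
  assumes \<theta>: "\<theta> \<in> \<Theta>"
  shows "AE \<omega> in Q \<theta>. 1 < X i \<omega>"
proof -
  have [measurable]: "X i \<in> borel_measurable (Q \<theta>)" by (rule X_measurable[OF \<theta>])
  have "AE x in distr (Q \<theta>) borel (X i). 1 < x"
    unfolding distr_eq_density[OF \<theta>]
    by (subst AE_density) (auto simp: pareto_density_def)
  then show ?thesis by (subst (asm) AE_distr_iff) auto
qed

text \<open>The cdf of \<open>ln (X i)\<close> at \<open>a\<close> is the Pareto cdf at
  \<open>exp a\<close>, which is \<open>1 - exp (- a * \<theta>)\<close>.\<close>

lemma ln_X_exponential:
  assumes \<theta>: "\<theta> \<in> \<Theta>"
  shows "distributed (Q \<theta>) lborel (\<lambda>\<omega>. ln (X i \<omega>)) (exponential_density \<theta>)"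
proof -
  interpret prob_space "Q \<theta>" by (rule prob[OF \<theta>])
  have [measurable]: "X i \<in> borel_measurable (Q \<theta>)" by (rule X_measurable[OF \<theta>])
  have "prob {\<omega> \<in> space (Q \<theta>). ln (X i \<omega>) \<le> a} = 1 - exp (- a * \<theta>)" if "0 \<le> a" for a
  \<comment> \<open>At \<open>a = 0\<close> the point \<open>exp a\<close> is 1, outside the range
    of \<open>cdf_pareto\<close>; there the event is null.\<close>
  proof (cases "a = 0")
    case True
    have "prob {\<omega> \<in> space (Q \<theta>). ln (X i \<omega>) \<le> 0} = prob {}"
      by (rule finite_measure_eq_AE) (use AE_X_gt_1[OF \<theta>, of i] in auto)
    then show ?thesis using True by simp
  next
    case False
    have "prob {\<omega> \<in> space (Q \<theta>). ln (X i \<omega>) \<le> a} = prob (X i -` {..exp a} \<inter> space (Q \<theta>))"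
    proof (rule finite_measure_eq_AE)
      show "AE \<omega> in Q \<theta>. (\<omega> \<in> {\<omega> \<in> space (Q \<theta>). ln (X i \<omega>) \<le> a}) =
          (\<omega> \<in> X i -` {..exp a} \<inter> space (Q \<theta>))"
        using AE_X_gt_1[OF \<theta>, of i] proof eventually_elim
          case (elim \<omega>)
          then show ?case using ln_le_cancel_iff[of "X i \<omega>" "exp a"] by auto
        qed
    qed auto
    also have "\<dots> = cdf (distr (Q \<theta>) borel (X i)) (exp a)"
      by (simp add: cdf_def measure_distr)
    also have "\<dots> = 1 - exp a powr (- \<theta>)"
      unfolding distr_eq_density[OF \<theta>] using False that pos[OF \<theta>] by (intro cdf_pareto) auto
    finally show ?thesis by (simp add: powr_def mult.commute)
  qed
  then show ?thesis
    using pos[OF \<theta>] by (subst exponential_distributed_iff) auto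
qed

text \<open>Chebyshev's inequality for the Erlang sum of the logarithms gives a failure probability
  of order 1/N. The almost sure condition \<open>1 < X i \<omega>\<close> is built into
  \<open>G N\<close> because the criteria for fixed observations need it pointwise.\<close>

lemma log_mean_lln:
  assumes \<theta>: "\<theta> \<in> \<Theta>" and \<epsilon>: "0 < \<epsilon>"
  defines "G \<equiv> \<lambda>N. {\<omega> \<in> space (Q \<theta>). (\<forall>i\<in>{1..N}. 1 < X i \<omega>) \<and>
      \<bar>log_mean N (\<lambda>i. X i \<omega>) - 1 / \<theta>\<bar> < \<epsilon>}"
  shows "G N \<in> sets (Q \<theta>)" and "(\<lambda>N. measure (Q \<theta>) (G N)) \<longlonglongrightarrow> 1"
proof -
  interpret prob_space "Q \<theta>" by (rule prob[OF \<theta>])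
  have [measurable]: "X i \<in> borel_measurable (Q \<theta>)" for i by (rule X_measurable[OF \<theta>])
  have \<theta>0: "0 < \<theta>" by (rule pos[OF \<theta>])
  show G: "G N \<in> sets (Q \<theta>)" for N unfolding G_def log_mean_def by measurable
  have lower: "1 - (1 / (\<theta>\<^sup>2 * \<epsilon>\<^sup>2)) * inverse (real N) \<le> prob (G N)" if N: "1 \<le> N" for N
  proof -
    define S where "S \<omega> = (\<Sum>i=1..N. ln (X i \<omega>))" for \<omega>
    have [measurable]: "S \<in> borel_measurable (Q \<theta>)" unfolding S_def by measurable
    have "indep_vars (\<lambda>_. borel) (\<lambda>i \<omega>. ln (X i \<omega>)) {1..N}"
      by (rule indep_vars_compose2[OF indep_vars_subset[OF indep[OF \<theta>]]]) auto
    \<comment> \<open>The shape index of \<open>erlang_density\<close> is one less than the number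
      of exponential summands.\<close>
    then have dist: "distributed (Q \<theta>) lborel S (erlang_density (card {1..N} - 1) \<theta>)"
      unfolding S_def [abs_def] using N \<theta>0 by (intro exponential_distributed_sum ln_X_exponential \<theta>) auto
    have E: "expectation S = real N / \<theta>"
    proof -
      obtain n where n: "N = Suc n" using N by (cases N) auto
      have "expectation S = fact (Suc n) / (fact n * \<theta>)"
        using erlang_ith_moment[OF \<theta>0 dist, of 1] by (simp add: n del: fact_Suc)
      also have "fact (Suc n) = real N * fact n" by (simp only: fact_Suc n)
      finally show ?thesis by simp
    qed
    have V: "variance S = real N / \<theta>\<^sup>2"
      using erlang_distributed_variance[OF \<theta>0 dist] N by (simp add: of_nat_diff)
    have "prob {\<omega> \<in> space (Q \<theta>). \<epsilon> * real N \<le> \<bar>S \<omega> - expectation S\<bar>} \<le> variance S / (\<epsilon> * real N)\<^sup>2"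
      using \<epsilon> N by (intro Chebyshev_inequality erlang_ith_moment_integrable[OF \<theta>0 dist]) auto
    also have "\<dots> = (1 / (\<theta>\<^sup>2 * \<epsilon>\<^sup>2)) * inverse (real N)"
      unfolding V using N \<epsilon> \<theta>0 by (simp add: field_simps power2_eq_square)
    finally have "1 - (1 / (\<theta>\<^sup>2 * \<epsilon>\<^sup>2)) * inverse (real N) \<le>
        1 - prob {\<omega> \<in> space (Q \<theta>). \<epsilon> * real N \<le> \<bar>S \<omega> - expectation S\<bar>}" by simp
    also have "\<dots> = prob (space (Q \<theta>) - {\<omega> \<in> space (Q \<theta>). \<epsilon> * real N \<le> \<bar>S \<omega> - expectation S\<bar>})"
      by (subst prob_compl) auto
    \<comment> \<open>The two events differ only where some observation is at most 1.\<close>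
    also have "\<dots> = prob (G N)"
    proof (rule finite_measure_eq_AE)
      have "AE \<omega> in Q \<theta>. \<forall>i\<in>{1..N}. 1 < X i \<omega>"
        by (rule AE_finite_allI) (auto intro: AE_X_gt_1[OF \<theta>])
      then show "AE \<omega> in Q \<theta>. (\<omega> \<in> space (Q \<theta>) - {\<omega> \<in> space (Q \<theta>).
          \<epsilon> * real N \<le> \<bar>S \<omega> - expectation S\<bar>}) = (\<omega> \<in> G N)"
      proof eventually_elim
        fix \<omega> assume gt: "\<forall>i\<in>{1..N}. 1 < X i \<omega>"
        have "log_mean N (\<lambda>i. X i \<omega>) - 1 / \<theta> = (S \<omega> - expectation S) / real N"
          unfolding E log_mean_def S_def using N by (simp add: diff_divide_distrib)
        then have "\<bar>log_mean N (\<lambda>i. X i \<omega>) - 1 / \<theta>\<bar> = \<bar>S \<omega> - expectation S\<bar> / real N"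
          by (simp add: abs_divide)
        then show "(\<omega> \<in> space (Q \<theta>) - {\<omega> \<in> space (Q \<theta>).
            \<epsilon> * real N \<le> \<bar>S \<omega> - expectation S\<bar>}) = (\<omega> \<in> G N)"
          using gt N by (auto simp: G_def divide_less_eq)
      qed
    qed (use G in auto)
    finally show ?thesis .
  qed
  show "(\<lambda>N. prob (G N)) \<longlonglongrightarrow> 1"
  proof (rule tendsto_sandwich)
    show "\<forall>\<^sub>F N in sequentially. 1 - (1 / (\<theta>\<^sup>2 * \<epsilon>\<^sup>2)) * inverse (real N) \<le> prob (G N)"
      using lower by (rule eventually_sequentiallyI)
    show "\<forall>\<^sub>F N in sequentially. prob (G N) \<le> 1" by simp
    have "(\<lambda>N. 1 - (1 / (\<theta>\<^sup>2 * \<epsilon>\<^sup>2)) * inverse (real N)) \<longlonglongrightarrow> 1 - (1 / (\<theta>\<^sup>2 * \<epsilon>\<^sup>2)) * 0"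
      by (rule tendsto_diff[OF tendsto_const tendsto_mult_left[OF lim_inverse_n]])
    then show "(\<lambda>N. 1 - (1 / (\<theta>\<^sup>2 * \<epsilon>\<^sup>2)) * inverse (real N)) \<longlonglongrightarrow> 1" by simp
  qed simp
qed

section \<open>Regularizability of the minmaxvar risk\<close>

lemma minmaxvar_risk:
  assumes "\<theta> \<in> \<Theta>" "0 < \<beta>"
  shows "distortion_risk (minmaxvar \<beta>) (distr (Q \<theta>) borel (X 0)) =
    (if 1 < \<theta> * \<beta> then ereal (\<theta> * \<beta> / (\<theta> * \<beta> - 1)) else \<infinity>)"
  using assms by (simp add: distr_eq_density distortion_risk_minmaxvar_pareto pos)

text \<open>Regularity would hold on events \<open>E N\<close>, and it fails on \<open>G N\<close>.
  Disjoint events cannot both have probability tending to 1.\<close>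

lemma not_regularizable_minmaxvar:
  assumes \<Theta>: "\<Theta> = {1<..}" and \<gamma>: "1 \<le> \<gamma>" and \<beta>: "0 < \<beta>" "\<beta> < 1"
  shows "\<not> regularizable \<Theta> Q X k \<gamma> (\<lambda>N. distortion_risk (minmaxvar \<beta>))"
proof
  assume regularizable: "regularizable \<Theta> Q X k \<gamma> (\<lambda>N. distortion_risk (minmaxvar \<beta>))"
  \<comment> \<open>Here \<open>1 / \<theta>\<close> is the midpoint of the interval from
    \<open>\<beta>\<close> to 1 and \<open>\<epsilon>\<close> is half its length. On
    \<open>G N\<close> the mean \<open>s\<close> thus satisfies \<open>\<beta> < s < 1\<close>, so
    \<open>1 / s\<close> lies in \<open>\<Theta>\<close> and \<open>\<beta> / s < 1\<close>.\<close>
  define \<theta> where "\<theta> = 2 / (1 + \<beta>)"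
  define \<epsilon> where "\<epsilon> = (1 - \<beta>) / 2"
  have \<theta>: "\<theta> \<in> \<Theta>" using \<beta> by (simp add: \<Theta> \<theta>_def field_simps)
  have \<epsilon>: "0 < \<epsilon>" using \<beta> by (simp add: \<epsilon>_def)
  interpret prob_space "Q \<theta>" by (rule prob[OF \<theta>])
  define G where "G N = {\<omega> \<in> space (Q \<theta>). (\<forall>i\<in>{1..N}. 1 < X i \<omega>) \<and>
      \<bar>log_mean N (\<lambda>i. X i \<omega>) - 1 / \<theta>\<bar> < \<epsilon>}" for N
  obtain \<delta> where "prob_tends_to_1 (Q \<theta>) (\<lambda>N \<omega>. regular \<Theta> k \<gamma> \<delta> N (\<lambda>i. X i \<omega>)
      (\<lambda>\<theta>. distortion_risk (minmaxvar \<beta>) (distr (Q \<theta>) borel (X 0))))"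
    using regularizable \<theta> unfolding regularizable_def by blast
  then obtain E where E: "\<forall>N. E N \<in> sets (Q \<theta>) \<and> (\<forall>\<omega>\<in>E N. regular \<Theta> k \<gamma> \<delta> N (\<lambda>i. X i \<omega>)
        (\<lambda>\<theta>. distortion_risk (minmaxvar \<beta>) (distr (Q \<theta>) borel (X 0))))"
      and E_lim: "(\<lambda>N. prob (E N)) \<longlonglongrightarrow> 1"
    unfolding prob_tends_to_1_def by (elim exE conjE)
  have G: "G N \<in> sets (Q \<theta>)" "(\<lambda>N. prob (G N)) \<longlonglongrightarrow> 1" for N
    using log_mean_lln[OF \<theta> \<epsilon>] by (simp_all add: G_def)
  have "E N \<inter> G N = {}" if N: "1 \<le> N" for N
  proof (rule ccontr)
    assume "E N \<inter> G N \<noteq> {}"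
    then obtain \<omega> where \<omega>: "\<omega> \<in> E N" "\<omega> \<in> G N" by blast
    let ?s = "log_mean N (\<lambda>i. X i \<omega>)"
    have gt: "\<And>i. i \<in> {1..N} \<Longrightarrow> 1 < X i \<omega>" and "\<bar>?s - 1 / \<theta>\<bar> < \<epsilon>"
      using \<omega> by (auto simp: G_def)
    moreover have "1 / \<theta> = \<beta> + \<epsilon>" "1 / \<theta> = 1 - \<epsilon>"
      using \<beta> by (auto simp: \<theta>_def \<epsilon>_def field_simps)
    ultimately have s: "\<beta> < ?s" "?s < 1" by linarith+
    then have mle: "1 / ?s \<in> \<Theta>" using \<beta> by (simp add: \<Theta> less_divide_eq)
    have "\<not> regular \<Theta> k \<gamma> \<delta> N (\<lambda>i. X i \<omega>)
        (\<lambda>\<theta>. distortion_risk (minmaxvar \<beta>) (distr (Q \<theta>) borel (X 0)))"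
      using s \<beta>
      by (intro not_regular_of_infinite_risk_at_mle[OF N gt pos mle _ \<gamma>])
         (auto simp: minmaxvar_risk[OF mle] less_divide_eq)
    then show False using E \<omega>(1) by blast
  qed
  then have "\<forall>\<^sub>F N in sequentially. prob (E N) + prob (G N) \<le> 1"
    using E G(1) by (intro eventually_sequentiallyI[of 1]) (simp flip: finite_measure_Union)
  moreover have "(\<lambda>N. prob (E N) + prob (G N)) \<longlonglongrightarrow> 1 + 1"
    by (intro tendsto_add E_lim G(2))
  ultimately have "1 + 1 \<le> (1::real)"
    by (intro tendsto_upperbound) auto
  then show False by simp
qed

text \<open>The bound \<open>1 / t \<le> \<beta> N\<close> makes the risk finite on all of
  \<open>\<Theta>\<close> and bounded uniformly in \<open>N\<close> on parameters at least
  \<open>m > t\<close>.\<close>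

lemma regularizable_minmaxvar:
  fixes \<beta> :: "nat \<Rightarrow> real"
  assumes \<Theta>: "\<Theta> = {t<..}" and t: "0 < t" and k: "0 < k" and \<gamma>: "1 \<le> \<gamma>" "\<gamma> < \<infinity>"
    and \<beta>: "\<And>N. 1 \<le> N \<Longrightarrow> 1 / t \<le> \<beta> N"
  shows "regularizable \<Theta> Q X k \<gamma> (\<lambda>N. distortion_risk (minmaxvar (\<beta> N)))"
  unfolding regularizable_def
\<comment> \<open>The level \<open>sqrt N\<close> tends to infinity, so the penalty outgrows the
  risk bound, yet is of smaller order than \<open>N\<close>, so the truncation localizes.\<close>
proof (intro exI[of _ "1 / 2"] conjI ballI)
  fix \<theta> assume \<theta>: "\<theta> \<in> \<Theta>"
  \<comment> \<open>The point \<open>m\<close> separates \<open>t\<close> from the true parameter.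
    The radius \<open>\<epsilon>\<close> is half the gap between \<open>1 / \<theta>\<close> and
    \<open>1 / m\<close>, so that \<open>m * s \<le> u < 1\<close> on \<open>G N\<close>.\<close>
  define m where "m = (t + \<theta>) / 2"
  define u where "u = (1 + m / \<theta>) / 2"
  define \<epsilon> where "\<epsilon> = (1 / m - 1 / \<theta>) / 2"
  have m: "t < m" "m < \<theta>" "0 < m" using \<theta> t by (auto simp: \<Theta> m_def)
  have u: "0 < u" "u < 1" using m by (auto simp: u_def field_simps)
  have \<epsilon>: "0 < \<epsilon>" using m by (simp add: \<epsilon>_def field_simps)
  have m_eq: "m * (1 / \<theta> + \<epsilon>) = u" using m by (simp add: \<epsilon>_def u_def field_simps)
  define G where "G N = {\<omega> \<in> space (Q \<theta>). (\<forall>i\<in>{1..N}. 1 < X i \<omega>) \<and>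
      \<bar>log_mean N (\<lambda>i. X i \<omega>) - 1 / \<theta>\<bar> < \<epsilon>}" for N
  have G: "G N \<in> sets (Q \<theta>)" "(\<lambda>N. measure (Q \<theta>) (G N)) \<longlonglongrightarrow> 1" for N
    using log_mean_lln[OF \<theta> \<epsilon>] by (simp_all add: G_def)
  have "filterlim (\<lambda>N. sqrt (real N)) at_top sequentially"
    by (rule filterlim_compose[OF sqrt_at_top filterlim_real_sequentially])
  \<comment> \<open>The summand 1 turns the weak inequality into the strict
    \<open>1 / psi u < sqrt N\<close>; the second entry of the maximum supplies
    \<open>large\<close>.\<close>
  then have "\<forall>\<^sub>F N in sequentially. max (1 / psi u + 1) (k * (m / (m - t))) \<le> sqrt (real N)"
    unfolding filterlim_at_top by blast
  then obtain N\<^sub>0 where N\<^sub>0: "\<And>N. N\<^sub>0 \<le> N \<Longrightarrow> max (1 / psi u + 1) (k * (m / (m - t))) \<le> sqrt (real N)"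
    by (auto simp: eventually_sequentially)
  show "prob_tends_to_1 (Q \<theta>) (\<lambda>N \<omega>. regular \<Theta> k \<gamma> (1 / 2) N (\<lambda>i. X i \<omega>)
      (\<lambda>\<theta>. distortion_risk (minmaxvar (\<beta> N)) (distr (Q \<theta>) borel (X 0))))"
    unfolding prob_tends_to_1_def
  \<comment> \<open>Below the threshold the witness is the empty event, which leaves the limit
    unchanged.\<close>
  proof (intro exI[of _ "\<lambda>N. if max 1 N\<^sub>0 \<le> N then G N else {}"] conjI allI ballI)
    show "(\<lambda>N. measure (Q \<theta>) (if max 1 N\<^sub>0 \<le> N then G N else {})) \<longlonglongrightarrow> 1"
      by (rule Lim_transform_eventually[OF G(2)]) (auto intro!: eventually_sequentiallyI[of "max 1 N\<^sub>0"])
  next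
    fix N \<omega> assume "\<omega> \<in> (if max 1 N\<^sub>0 \<le> N then G N else {})"
    then have N: "1 \<le> N" "N\<^sub>0 \<le> N" and \<omega>: "\<omega> \<in> G N" by (auto split: if_splits)
    let ?s = "log_mean N (\<lambda>i. X i \<omega>)"
    have gt: "\<And>i. i \<in> {1..N} \<Longrightarrow> 1 < X i \<omega>" and "\<bar>?s - 1 / \<theta>\<bar> < \<epsilon>"
      using \<omega> by (auto simp: G_def)
    then have "m * ?s \<le> m * (1 / \<theta> + \<epsilon>)" using m by (intro mult_left_mono) auto
    then have ms: "m * ?s \<le> u" unfolding m_eq .
    have "0 < ?s" by (rule log_mean_pos[OF N(1) gt])
    have "1 < psi u * sqrt (real N)"
    proof -
      have "1 / psi u < sqrt (real N)" using N\<^sub>0[OF N(2)] by simp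
      then show ?thesis using psi_pos[OF u] by (simp add: divide_less_eq mult.commute)
    qed
    also have "psi u * sqrt (real N) \<le> psi (m * ?s) * sqrt (real N)"
      using ms u m \<open>0 < ?s\<close> by (intro mult_right_mono psi_antimono) auto
    finally have "sqrt (real N) * 1 < sqrt (real N) * (psi (m * ?s) * sqrt (real N))"
      using N by (intro mult_strict_left_mono) auto
    moreover have "sqrt (real N) * (psi (m * ?s) * sqrt (real N)) =
        (sqrt (real N) * sqrt (real N)) * psi (m * ?s)"
      by (metis mult.assoc mult.commute)
    ultimately have small: "sqrt (real N) < real N * psi (m * ?s)" by simp
    have \<beta>0: "0 < \<beta> N"
      using \<beta>[OF N(1)] t by (simp add: less_le_trans[of 0 "1 / t"])
    have r: "distortion_risk (minmaxvar (\<beta> N)) (distr (Q \<theta>') borel (X 0)) =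
        ereal (\<theta>' * \<beta> N / (\<theta>' * \<beta> N - 1))" if "t < \<theta>'" for \<theta>'
    proof -
      have "t * (1 / t) < \<theta>' * \<beta> N"
        using that t \<beta>[OF N(1)] by (intro mult_less_le_imp_less) auto
      then show ?thesis
        using that t \<beta>0 by (simp add: minmaxvar_risk \<Theta>)
    qed
    show "regular \<Theta> k \<gamma> (1 / 2) N (\<lambda>i. X i \<omega>)
        (\<lambda>\<theta>. distortion_risk (minmaxvar (\<beta> N)) (distr (Q \<theta>) borel (X 0)))"
      unfolding \<Theta>
    proof (rule regular_minmaxvar_risk[where m = m and \<beta> = "\<beta> N"])
      show "1 < X i \<omega>" if "i \<in> {1..N}" for i using gt that by blast
      show "m * ?s < 1" using ms u by linarith
      show "real N powr (1 / 2) < real N * psi (m * ?s)"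
        using small by (simp add: powr_half_sqrt)
      show "k * (m / (m - t)) \<le> real N powr (1 / 2)"
        using N\<^sub>0[OF N(2)] by (simp add: powr_half_sqrt)
      show "distortion_risk (minmaxvar (\<beta> N)) (distr (Q \<theta>') borel (X 0)) =
          ereal (\<theta>' * \<beta> N / (\<theta>' * \<beta> N - 1))" if "t < \<theta>'" for \<theta>'
        by (rule r[OF that])
    qed (fact N(1) t m(1) k \<gamma> \<beta>[OF N(1)])+
  next
    show "(if max 1 N\<^sub>0 \<le> N then G N else {}) \<in> sets (Q \<theta>)" for N
      using G(1) by simp
  qed
qed simp

end

theorem theorem7:
  fixes \<Theta> :: "real set" and Q :: "real \<Rightarrow> 'a measure" and X :: "nat \<Rightarrow> 'a \<Rightarrow> real"
    and k :: real and \<gamma> :: ereal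
  assumes "pareto_model \<Theta> Q X" and "k > 0" and "1 \<le> \<gamma>"
  shows
    "(\<Theta> = {1<..} \<longrightarrow>
        (\<forall>\<beta>::real. 0 < \<beta> \<and> \<beta> < 1 \<longrightarrow>
           \<not> regularizable \<Theta> Q X k \<gamma> (\<lambda>N. distortion_risk (minmaxvar \<beta>)))) \<and>
     (\<forall>(t::real) (\<beta> :: nat \<Rightarrow> real) (h :: nat \<Rightarrow> real) (\<eta>::real).
        t > 1 \<and> \<Theta> = {t<..} \<and> \<gamma> < \<infinity> \<and>
        (\<gamma> = 1 \<and> \<eta> = 1 / 4 \<or> \<eta> < 1 / 4) \<and>
        (\<forall>N\<ge>1. 0 < \<beta> N \<and> \<beta> N \<le> 1) \<and>
        (\<forall>N\<ge>1. h N \<noteq> 0) \<and> h \<in> O(\<lambda>N. real N powr \<eta>) \<and>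
        (\<forall>N\<ge>1. \<beta> N \<ge> 1 / t + 1 / \<bar>h N\<bar>) \<longrightarrow>
        regularizable \<Theta> Q X k \<gamma> (\<lambda>N. distortion_risk (minmaxvar (\<beta> N))))"
proof -
  interpret pareto_model \<Theta> Q X by fact
  show ?thesis
  proof (intro conjI allI impI; (elim conjE)?)
    fix \<beta> :: real
    assume "\<Theta> = {1<..}" "0 < \<beta>" "\<beta> < 1"
    then show "\<not> regularizable \<Theta> Q X k \<gamma> (\<lambda>N. distortion_risk (minmaxvar \<beta>))"
      using \<open>1 \<le> \<gamma>\<close> by (intro not_regularizable_minmaxvar)
  next
    fix t \<eta> :: real and \<beta> h :: "nat \<Rightarrow> real"
    assume t: "1 < t" and "\<Theta> = {t<..}" "\<gamma> < \<infinity>"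
      and \<beta>: "\<forall>N\<ge>1. \<beta> N \<ge> 1 / t + 1 / \<bar>h N\<bar>"
    have "1 / t \<le> \<beta> N" if "1 \<le> N" for N
    proof -
      \<comment> \<open>Dropping this nonnegative term from the assumed lower bound leaves
        \<open>1 / t \<le> \<beta> N\<close>.\<close>
      have "0 \<le> 1 / \<bar>h N\<bar>" by simp
      then show ?thesis using \<beta> that by (meson add_increasing2 order_trans order_refl)
    qed
    then show "regularizable \<Theta> Q X k \<gamma> (\<lambda>N. distortion_risk (minmaxvar (\<beta> N)))"
      using \<open>k > 0\<close> \<open>1 \<le> \<gamma>\<close> \<open>\<Theta> = {t<..}\<close> \<open>\<gamma> < \<infinity>\<close> t by (intro regularizable_minmaxvar[of t]) auto
  qed
qed

end
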